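(* Let $T$ be an $\aleph_1$-tree. Then $T$, equipped with the fine wedge topology, is Lindelöf if and only if every finitely splitting subtree of $T$ is countable.
   Context: A tree is a strict partial order $(T,<)$ in which $\{y:y<x\}$ is well-ordered for every $x$; the height of $x$ is the order type of $\{y:y<x\}$, level $T_\alpha$ is the set of nodes of height $\alpha$, and the height of $T$ is the least $\alpha$ with $T_\alpha=\emptyset$. An $\aleph_1$-tree is a tree of height $\omega_1$ all of whose levels are countable. A subtree of $T$ is a set $S\subseteq T$ that is downward closed in $T$. For $x\in S$, $I_S(x)$ denotes the set of immediate successors of $x$ in $S$; $S$ is finitely splitting if $I_S(x)$ is finite for every $x\in S$. For $t\in T$ let $\uparrow t=\{y\in T:t\le y\}$. The fine wedge topology on $T$ is the topology generated by the subbase consisting of all sets $\uparrow t$ and their complements $T\setminus\uparrow t$, $t\in T$. Lindelöf means every open cover has a countable subcover. *)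

theory Defs
  imports "HOL-Analysis.Analysis"
begin

definition tree_preds :: "'a set \<Rightarrow> ('a \<Rightarrow> 'a \<Rightarrow> bool) \<Rightarrow> 'a \<Rightarrow> 'a set" where
  "tree_preds T lt x = {y \<in> T. lt y x}"

text \<open>The library's well-orders are reflexive relations, so the strict order of the tree
  is made reflexive when it is restricted to the predecessors of a node.\<close>

definition tree_preds_order :: "'a set \<Rightarrow> ('a \<Rightarrow> 'a \<Rightarrow> bool) \<Rightarrow> 'a \<Rightarrow> 'a rel" where
  "tree_preds_order T lt x =
     {(y, z). y \<in> tree_preds T lt x \<and> z \<in> tree_preds T lt x \<and> (y = z \<or> lt y z)}"

definition is_tree :: "'a set \<Rightarrow> ('a \<Rightarrow> 'a \<Rightarrow> bool) \<Rightarrow> bool" where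
  "is_tree T lt \<longleftrightarrow> irreflp_on T lt \<and> transp_on T lt \<and>
     (\<forall>x\<in>T. well_order_on (tree_preds T lt x) (tree_preds_order T lt x))"

text \<open>Ordinals are represented by well-order relations, up to \<open>ordIso\<close>.
  In \<open>tree_has_height\<close> it suffices to let \<open>\<beta>\<close> range over relations on the same type as
  \<open>\<alpha>\<close>, because every smaller ordinal is the order type of an initial segment of \<open>\<alpha>\<close>.\<close>

definition tree_level :: "'a set \<Rightarrow> ('a \<Rightarrow> 'a \<Rightarrow> bool) \<Rightarrow> 'b rel \<Rightarrow> 'a set" where
  "tree_level T lt \<alpha> = {x \<in> T. (tree_preds_order T lt x, \<alpha>) \<in> ordIso}"

definition tree_has_height :: "'a set \<Rightarrow> ('a \<Rightarrow> 'a \<Rightarrow> bool) \<Rightarrow> 'b rel \<Rightarrow> bool" where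
  "tree_has_height T lt \<alpha> \<longleftrightarrow> Well_order \<alpha> \<and> tree_level T lt \<alpha> = {} \<and>
     (\<forall>\<beta> :: 'b rel. (\<beta>, \<alpha>) \<in> ordLess \<longrightarrow> tree_level T lt \<beta> \<noteq> {})"

text \<open>The first uncountable ordinal, as a well-order on a subset of \<open>nat set\<close>.\<close>

abbreviation omega1 :: "nat set rel" where
  "omega1 \<equiv> cardSuc natLeq"

definition aleph1_tree :: "'a set \<Rightarrow> ('a \<Rightarrow> 'a \<Rightarrow> bool) \<Rightarrow> bool" where
  "aleph1_tree T lt \<longleftrightarrow> is_tree T lt \<and> tree_has_height T lt omega1 \<and>
     (\<forall>\<alpha> :: nat set rel. (\<alpha>, omega1) \<in> ordLess \<longrightarrow> countable (tree_level T lt \<alpha>))"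

definition subtree :: "'a set \<Rightarrow> 'a set \<Rightarrow> ('a \<Rightarrow> 'a \<Rightarrow> bool) \<Rightarrow> bool" where
  "subtree S T lt \<longleftrightarrow> S \<subseteq> T \<and> (\<forall>x\<in>S. \<forall>y\<in>T. lt y x \<longrightarrow> y \<in> S)"

definition imm_succs :: "'a set \<Rightarrow> ('a \<Rightarrow> 'a \<Rightarrow> bool) \<Rightarrow> 'a \<Rightarrow> 'a set" where
  "imm_succs S lt x = {y \<in> S. lt x y \<and> \<not> (\<exists>z\<in>S. lt x z \<and> lt z y)}"

definition finitely_splitting :: "'a set \<Rightarrow> ('a \<Rightarrow> 'a \<Rightarrow> bool) \<Rightarrow> bool" where
  "finitely_splitting S lt \<longleftrightarrow> (\<forall>x\<in>S. finite (imm_succs S lt x))"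

definition tree_up :: "'a set \<Rightarrow> ('a \<Rightarrow> 'a \<Rightarrow> bool) \<Rightarrow> 'a \<Rightarrow> 'a set" where
  "tree_up T lt t = {y \<in> T. t = y \<or> lt t y}"

definition fine_wedge_topology :: "'a set \<Rightarrow> ('a \<Rightarrow> 'a \<Rightarrow> bool) \<Rightarrow> 'a topology" where
  "fine_wedge_topology T lt =
     topology_generated_by ({tree_up T lt t | t. t \<in> T} \<union> {T - tree_up T lt t | t. t \<in> T})"

lemma topspace_fine_wedge_topology [simp]: "topspace (fine_wedge_topology T lt) = T"
  unfolding fine_wedge_topology_def topology_generated_by_topspace
  by (auto simp: tree_up_def)

end

theory Submission
  imports Defs
begin

text \<open>In a tree, the sets \<open>\<up>x - \<Union>{\<up>t | t \<in> F}\<close>, with \<open>F\<close> a finite set of immediate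
  successors of \<open>x\<close>, form a neighbourhood base at \<open>x\<close>. Given an open cover, choose for every
  \<open>x\<close> such a set \<open>F x\<close> whose neighbourhood lies in a member of the cover. The nodes reached by
  following only chosen successors form a finitely splitting subtree \<open>S\<close>, and the
  neighbourhoods of the nodes of \<open>S\<close> cover the whole tree, since a path leaving \<open>S\<close> has a first
  node at which it takes a successor that was not chosen.
  Conversely, a finitely splitting subtree is a closed discrete subspace, so it is countable
  if the tree is Lindelof.\<close>

section \<open>Order theory of trees\<close>

lemma tree_lt_trans:
  assumes "is_tree T lt" "x \<in> T" "y \<in> T" "z \<in> T" "lt x y" "lt y z"
  shows "lt x z"
  using assms unfolding is_tree_def by (meson transp_onD)

lemma tree_lt_irrefl:
  assumes "is_tree T lt" "x \<in> T"
  shows "\<not> lt x x"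
  using assms unfolding is_tree_def by (meson irreflp_onD)

text \<open>The predecessors of \<open>z\<close> are well-ordered, hence totally ordered; if
  \<open>x\<close> or \<open>y\<close> equals \<open>z\<close>, the hypotheses already compare
  them.\<close>

lemma tree_lower_bounds_comparable:
  assumes T: "is_tree T lt" "x \<in> T" "y \<in> T" "z \<in> T"
    and le: "x = z \<or> lt x z" "y = z \<or> lt y z"
  shows "x = y \<or> lt x y \<or> lt y x"
proof (cases "x = z \<or> y = z")
  case False
  then have "x \<in> tree_preds T lt z" "y \<in> tree_preds T lt z"
    using T le by (auto simp: tree_preds_def)
  moreover have "total_on (tree_preds T lt z) (tree_preds_order T lt z)"
    using T unfolding is_tree_def well_order_on_def linear_order_on_def by blast
  ultimately show ?thesis
    unfolding total_on_def tree_preds_order_def by blast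
qed (use le in auto)

lemma tree_minimal_pred:
  assumes T: "is_tree T lt" "z \<in> T" and A: "A \<subseteq> tree_preds T lt z" "A \<noteq> {}"
  obtains m where "m \<in> A" "\<And>y. y \<in> A \<Longrightarrow> \<not> lt y m"
proof -
  have "wf (tree_preds_order T lt z - Id)"
    using T unfolding is_tree_def well_order_on_def by blast
  then obtain m where m: "m \<in> A" "\<And>y. (y, m) \<in> tree_preds_order T lt z - Id \<Longrightarrow> y \<notin> A"
    using A(2) by (metis wf_eq_minimal ex_in_conv)
  have "\<not> lt y m" if y: "y \<in> A" for y
  proof
    assume "lt y m"
    moreover have "y \<noteq> m"
      using \<open>lt y m\<close> tree_lt_irrefl[OF T(1), of m] m(1) A(1) by (auto simp: tree_preds_def)
    ultimately have "(y, m) \<in> tree_preds_order T lt z - Id"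
      using y m(1) A(1) by (auto simp: tree_preds_order_def)
    with m(2) y show False by blast
  qed
  with m(1) that show thesis by blast
qed

text \<open>If \<open>t\<close> is not itself an immediate successor of \<open>x\<close>, the open
  interval from \<open>x\<close> to \<open>t\<close> is nonempty. A minimal element of it has
  nothing strictly between \<open>x\<close> and itself, by transitivity.\<close>

lemma tree_imm_succ_below:
  assumes T: "is_tree T lt" "x \<in> T" "t \<in> T" and lt: "lt x t"
  obtains s where "s \<in> imm_succs T lt x" "s = t \<or> lt s t"
proof (cases "t \<in> imm_succs T lt x")
  case False
  define A where "A = {s \<in> T. lt x s \<and> lt s t}"
  have "A \<noteq> {}" "A \<subseteq> tree_preds T lt t"
    using False T lt by (auto simp: A_def imm_succs_def tree_preds_def)
  then obtain s where s: "s \<in> A" "\<And>y. y \<in> A \<Longrightarrow> \<not> lt y s"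
    using tree_minimal_pred[OF T(1,3)] by metis
  have "s \<in> imm_succs T lt x"
    using s tree_lt_trans[OF T(1) _ _ T(3)] unfolding imm_succs_def A_def by blast
  with s(1) that show thesis by (auto simp: A_def)
qed (use that in blast)

text \<open>Both \<open>t\<close> and \<open>z\<close> lie at or below \<open>x\<close>, so they are
  comparable, and \<open>z\<close> strictly below \<open>t\<close> would separate \<open>y\<close>
  from its immediate successor \<open>t\<close>.\<close>

lemma imm_succ_below_upper_bound:
  assumes T: "is_tree T lt" and t: "t \<in> imm_succs T lt y"
    and z: "x \<in> T" "z \<in> T" "lt y z" "z = x \<or> lt z x" "t = x \<or> lt t x"
  shows "t = z \<or> lt t z"
  using tree_lower_bounds_comparable[OF T, of t z x] t z by (auto simp: imm_succs_def)

section \<open>Wedges and neighbourhoods in the fine wedge topology\<close>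

lemma openin_fine_wedge_up:
  "t \<in> T \<Longrightarrow> openin (fine_wedge_topology T lt) (tree_up T lt t)"
  unfolding fine_wedge_topology_def by (rule topology_generated_by_Basis) blast

lemma closedin_fine_wedge_up:
  assumes "t \<in> T"
  shows "closedin (fine_wedge_topology T lt) (tree_up T lt t)"
proof -
  have "openin (fine_wedge_topology T lt) (T - tree_up T lt t)"
    unfolding fine_wedge_topology_def
    by (rule topology_generated_by_Basis) (use assms in blast)
  then show ?thesis
    by (auto simp: closedin_def tree_up_def)
qed

text \<open>Induction on the generation of open sets: an intersection unites the two exception sets,
  a union keeps one of them, and a subbasic set needs at most one exception.\<close>

lemma fine_wedge_nhd_base:
  assumes T: "is_tree T lt" and U: "openin (fine_wedge_topology T lt) U" and "x \<in> U"
  obtains F where "finite F" "F \<subseteq> imm_succs T lt x"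
    "tree_up T lt x - (\<Union>t\<in>F. tree_up T lt t) \<subseteq> U"
proof -
  let ?N = "\<lambda>U x. \<exists>F. finite F \<and> F \<subseteq> imm_succs T lt x \<and>
    tree_up T lt x - (\<Union>t\<in>F. tree_up T lt t) \<subseteq> U"
  have "generate_topology_on
      ({tree_up T lt t | t. t \<in> T} \<union> {T - tree_up T lt t | t. t \<in> T}) U"
    using U by (simp add: fine_wedge_topology_def openin_topology_generated_by_iff)
  then have "\<forall>x\<in>U. ?N U x"
  proof induction
    case Empty
    then show ?case by simp
  next
    case (Int a b)
    show ?case
    proof
      fix x assume "x \<in> a \<inter> b"
      with Int.IH have "?N a x" "?N b x" by auto
      then obtain F G where "finite F" "F \<subseteq> imm_succs T lt x"
        "tree_up T lt x - (\<Union>t\<in>F. tree_up T lt t) \<subseteq> a"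
        "finite G" "G \<subseteq> imm_succs T lt x" "tree_up T lt x - (\<Union>t\<in>G. tree_up T lt t) \<subseteq> b" by auto
      then show "?N (a \<inter> b) x"
        by (intro exI[of _ "F \<union> G"]) auto
    qed
  next
    case (UN K)
    show ?case
    proof
      fix x assume "x \<in> \<Union>K"
      then obtain k where k: "k \<in> K" "x \<in> k" by blast
      with UN.IH have "?N k x" by auto
      then obtain F where "finite F" "F \<subseteq> imm_succs T lt x"
        "tree_up T lt x - (\<Union>t\<in>F. tree_up T lt t) \<subseteq> k" by blast
      then show "?N (\<Union>K) x" using k(1) by (intro exI[of _ F]) auto
    qed
  next
    case (Basis s)
    then consider (up) t where "t \<in> T" "s = tree_up T lt t"
      | (co) t where "t \<in> T" "s = T - tree_up T lt t" by blast
    then show ?case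
    proof cases
      case up
      then have "tree_up T lt x \<subseteq> s" if "x \<in> s" for x
        using that tree_lt_trans[OF T, of t x] by (auto simp: tree_up_def)
      then show ?thesis by (intro ballI exI[of _ "{}"]) auto
    next
      case co
      show ?thesis
      proof
        fix x assume x: "x \<in> s"
        then have xT: "x \<in> T" using co by blast
        show "?N s x"
        proof (cases "lt x t")
          \<comment> \<open>The wedge at \<open>x\<close> contains that at \<open>t\<close>.
            Removing the wedge of the one immediate successor of \<open>x\<close> on the way to
            \<open>t\<close> removes all of it.\<close>
          case True
          then obtain r where r: "r \<in> imm_succs T lt x" "r = t \<or> lt r t"
            using tree_imm_succ_below[OF T xT co(1)] by blast
          then have "r \<in> T" by (simp add: imm_succs_def)
          then have "tree_up T lt t \<subseteq> tree_up T lt r"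
            using r(2) co(1) tree_lt_trans[OF T, of r t] by (auto simp: tree_up_def)
          with r(1) co show ?thesis
            by (intro exI[of _ "{r}"]) (auto simp: tree_up_def)
        next
          case False
          \<comment> \<open>Here \<open>x\<close> and \<open>t\<close> are incomparable, so they
            have no common upper bound.\<close>
          have "tree_up T lt x \<inter> tree_up T lt t = {}"
            using tree_lower_bounds_comparable[OF T xT co(1)] False x co
            by (auto simp: tree_up_def)
          then show ?thesis
            using co by (intro exI[of _ "{}"]) (auto simp: tree_up_def)
        qed
      qed
    qed
  qed
  with \<open>x \<in> U\<close> that show thesis by blast
qed

section \<open>From Lindelof to countable subtrees\<close>

lemma countable_finitely_splitting_if_Lindelof_fine_wedge:
  assumes T: "is_tree T lt" and L: "Lindelof_space (fine_wedge_topology T lt)"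
    and S: "subtree S T lt" "finitely_splitting S lt"
  shows "countable S"
proof -
  let ?X = "fine_wedge_topology T lt"
  define V where "V x = tree_up T lt x - (\<Union>t\<in>imm_succs S lt x. tree_up T lt t)" for x
  have ST: "S \<subseteq> T" using S(1) by (simp add: subtree_def)
  have imm_succs_eq: "imm_succs S lt x = imm_succs T lt x \<inter> S" if "x \<in> S" for x
    using that S(1) unfolding subtree_def imm_succs_def by blast
  have openV: "openin ?X (V x)" if "x \<in> S" for x
  proof -
    \<comment> \<open>Finite splitting enters here: only a finite union of closed wedges is closed
      in general.\<close>
    have "closedin ?X (\<Union>t\<in>imm_succs S lt x. tree_up T lt t)"
      using that S(2) ST
      by (intro closedin_Union)
         (auto simp: finitely_splitting_def imm_succs_def intro: closedin_fine_wedge_up)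
    then show ?thesis
      unfolding V_def using that ST by (blast intro: openin_diff openin_fine_wedge_up)
  qed
  have V_Int_S: "V x \<inter> S = {x}" if "x \<in> S" for x
  proof -
    have "\<not> lt t x" if "t \<in> imm_succs S lt x" for t
      using that ST \<open>x \<in> S\<close> tree_lt_trans[OF T, of x t x] tree_lt_irrefl[OF T, of x]
      by (auto simp: imm_succs_def)
    moreover have "x \<notin> imm_succs S lt x"
      using that ST tree_lt_irrefl[OF T, of x] by (auto simp: imm_succs_def)
    ultimately have "x \<in> V x"
      using that ST by (auto simp: V_def tree_up_def)
    moreover have "y = x" if y: "y \<in> V x" "y \<in> S" for y
    proof (rule ccontr)
      assume "y \<noteq> x"
      with y have "lt x y" by (auto simp: V_def tree_up_def)
      \<comment> \<open>Downward closure puts \<open>s\<close> into \<open>S\<close>, so its wedge,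
        which contains \<open>y\<close>, was cut out of \<open>V x\<close>.\<close>
      then obtain s where s: "s \<in> imm_succs T lt x" "s = y \<or> lt s y"
        using tree_imm_succ_below[OF T] y(2) \<open>x \<in> S\<close> ST by blast
      then have "s \<in> S"
        using y(2) S(1) by (auto simp: subtree_def imm_succs_def)
      with s y ST imm_succs_eq[OF \<open>x \<in> S\<close>] show False
        by (auto simp: V_def tree_up_def)
    qed
    ultimately show ?thesis using that by blast
  qed
  have V_mem: "x \<in> V x" if "x \<in> S" for x
    using V_Int_S[OF that] by blast
  have "openin ?X (T - S)"
  proof -
    \<comment> \<open>The complement of a downward closed set is upward closed.\<close>
    have "T - S = (\<Union>t\<in>T - S. tree_up T lt t)"
      using S(1) by (auto simp: subtree_def tree_up_def)
    moreover have "openin ?X (\<Union>t\<in>T - S. tree_up T lt t)"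
      by (intro openin_Union) (auto intro: openin_fine_wedge_up)
    ultimately show ?thesis by simp
  qed
  with openV have "\<forall>U\<in>insert (T - S) (V ` S). openin ?X U" by blast
  moreover have "\<Union>(insert (T - S) (V ` S)) = topspace ?X"
    unfolding topspace_fine_wedge_topology
  proof
    show "\<Union>(insert (T - S) (V ` S)) \<subseteq> T" by (auto simp: V_def tree_up_def)
    show "T \<subseteq> \<Union>(insert (T - S) (V ` S))" using V_mem by blast
  qed
  ultimately obtain W where W: "countable W" "W \<subseteq> insert (T - S) (V ` S)" "\<Union>W = T"
    using L unfolding Lindelof_space_def topspace_fine_wedge_topology by meson
  have "inj_on V S"
  proof
    fix x y assume "x \<in> S" "y \<in> S" "V x = V y"
    then have "{x} = {y}" using V_Int_S by metis
    then show "x = y" by (rule singleton_inject)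
  qed
  \<comment> \<open>No subcover can omit \<open>V x\<close>: it is the only member of the cover that
    contains \<open>x\<close>.\<close>
  moreover have "V ` S \<subseteq> W"
  proof
    fix v assume "v \<in> V ` S"
    then obtain x where x: "x \<in> S" "v = V x" by blast
    then obtain w where w: "w \<in> W" "x \<in> w" using W(3) ST by blast
    then obtain y where "y \<in> S" "w = V y" using W(2) x(1) by blast
    then have "x \<in> {y}" using V_Int_S[OF \<open>y \<in> S\<close>] w(2) x(1) by auto
    with x(2) w(1) \<open>w = V y\<close> show "v \<in> W" by simp
  qed
  ultimately show "countable S"
    using W(1) countable_image_inj_on countable_subset by blast
qed

section \<open>From countable subtrees to Lindelof\<close>

lemma Lindelof_fine_wedge_if_countable_finitely_splitting:
  assumes T: "is_tree T lt"
    and C: "\<And>S. subtree S T lt \<Longrightarrow> finitely_splitting S lt \<Longrightarrow> countable S"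
  shows "Lindelof_space (fine_wedge_topology T lt)"
  unfolding Lindelof_space_def topspace_fine_wedge_topology
proof (intro allI impI)
  fix \<U>
  assume \<U>: "(\<forall>U\<in>\<U>. openin (fine_wedge_topology T lt) U) \<and> \<Union>\<U> = T"
  have "\<forall>x\<in>T. \<exists>F U. U \<in> \<U> \<and> finite F \<and> F \<subseteq> imm_succs T lt x \<and>
      tree_up T lt x - (\<Union>t\<in>F. tree_up T lt t) \<subseteq> U"
  proof
    fix x assume x: "x \<in> T"
    obtain U where U: "U \<in> \<U>" "x \<in> U" using x \<U> by blast
    then have "openin (fine_wedge_topology T lt) U" using \<U> by blast
    then obtain F where "finite F" "F \<subseteq> imm_succs T lt x"
      "tree_up T lt x - (\<Union>t\<in>F. tree_up T lt t) \<subseteq> U"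
      using fine_wedge_nhd_base[OF T] U(2) by metis
    with U(1) show "\<exists>F U. U \<in> \<U> \<and> finite F \<and> F \<subseteq> imm_succs T lt x \<and>
      tree_up T lt x - (\<Union>t\<in>F. tree_up T lt t) \<subseteq> U" by (intro exI[of _ F] exI[of _ U]) simp
  qed
  then obtain F U where "\<forall>x\<in>T. U x \<in> \<U> \<and> finite (F x) \<and> F x \<subseteq> imm_succs T lt x \<and>
      tree_up T lt x - (\<Union>t\<in>F x. tree_up T lt t) \<subseteq> U x"
    unfolding bchoice_iff by iprover
  then have FU: "U x \<in> \<U>" "finite (F x)" "F x \<subseteq> imm_succs T lt x"
    "tree_up T lt x - (\<Union>t\<in>F x. tree_up T lt t) \<subseteq> U x" if "x \<in> T" for x
    using that by simp_all
  \<comment> \<open>Membership is a condition on all predecessors of \<open>x\<close> at once, so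
    limit nodes need no separate treatment.\<close>
  define S where "S = {x \<in> T. \<forall>y\<in>T. lt y x \<longrightarrow> (\<exists>t\<in>F y. t = x \<or> lt t x)}"
  have sub: "subtree S T lt"
    unfolding subtree_def
  proof (intro conjI ballI impI)
    show "S \<subseteq> T" by (auto simp: S_def)
    fix x z assume xz: "x \<in> S" "z \<in> T" "lt z x"
    have "\<exists>t\<in>F y. t = z \<or> lt t z" if y: "y \<in> T" "lt y z" for y
    proof -
      have "lt y x" using tree_lt_trans[OF T, of y z x] xz y by (auto simp: S_def)
      then obtain t where "t \<in> F y" "t = x \<or> lt t x" using xz(1) y(1) by (auto simp: S_def)
      then show ?thesis
        using imm_succ_below_upper_bound[OF T, of t y x z] FU(3) xz y by (auto simp: S_def)
    qed
    with xz(2) show "z \<in> S" by (auto simp: S_def)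
  qed
  \<comment> \<open>A chosen successor \<open>t\<close> of \<open>x\<close> lies at or below
    \<open>z\<close>. If it were strictly below, it would be a node of \<open>S\<close> between
    \<open>x\<close> and \<open>z\<close>, so \<open>t = z\<close>.\<close>
  have "imm_succs S lt x \<subseteq> F x" if x: "x \<in> S" for x
  proof
    fix z assume z: "z \<in> imm_succs S lt x"
    then obtain t where t: "t \<in> F x" "t = z \<or> lt t z"
      using x by (auto simp: S_def imm_succs_def)
    then have tx: "t \<in> T" "lt x t"
      using FU(3)[of x] x by (auto simp: S_def imm_succs_def)
    have "t \<in> S" if "lt t z"
      using that tx(1) sub z by (auto simp: subtree_def imm_succs_def)
    with t tx z show "z \<in> F x" by (auto simp: imm_succs_def)
  qed
  then have "finitely_splitting S lt"
    using FU(2) unfolding finitely_splitting_def S_def by (blast intro: finite_subset)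
  with C sub have "countable S" by blast
  have "z \<in> \<Union>(U ` S)" if z: "z \<in> T" for z
  proof -
    have "\<exists>y\<in>S. z \<in> tree_up T lt y - (\<Union>t\<in>F y. tree_up T lt t)"
    proof (cases "z \<in> S")
      case True
      have "z \<notin> tree_up T lt t" if "t \<in> F z" for t
        using FU(3)[OF z] that z tree_lt_trans[OF T, of z t z] tree_lt_irrefl[OF T z]
        by (auto simp: imm_succs_def tree_up_def)
      with True z show ?thesis by (auto simp: tree_up_def)
    next
      case False
      \<comment> \<open>These are the nodes at which the path to \<open>z\<close> takes a successor
        that was not chosen; \<open>z\<close> outside \<open>S\<close> makes the set
        nonempty.\<close>
      define A where "A = {y \<in> T. lt y z \<and> \<not> (\<exists>t\<in>F y. t = z \<or> lt t z)}"
      have "A \<subseteq> tree_preds T lt z" "A \<noteq> {}"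
        using False z by (auto simp: A_def S_def tree_preds_def)
      then obtain m where m: "m \<in> A" "\<And>y. y \<in> A \<Longrightarrow> \<not> lt y m"
        using tree_minimal_pred[OF T z] by metis
      \<comment> \<open>By minimality of \<open>m\<close>, the path to \<open>z\<close> takes a
        chosen successor at \<open>w\<close>. As \<open>m\<close> lies on that path above
        \<open>w\<close>, this successor is at or below \<open>m\<close>.\<close>
      have "\<exists>t\<in>F w. t = m \<or> lt t m" if w: "w \<in> T" "lt w m" for w
      proof -
        have "lt w z" using tree_lt_trans[OF T, of w m z] m(1) w z by (auto simp: A_def)
        then obtain t where "t \<in> F w" "t = z \<or> lt t z" using m(2)[of w] w by (auto simp: A_def)
        then show ?thesis
          using imm_succ_below_upper_bound[OF T, of t w z m] FU(3) m(1) w z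
          by (auto simp: A_def)
      qed
      then have "m \<in> S" using m(1) by (auto simp: S_def A_def)
      with m(1) z show ?thesis by (intro bexI[of _ m]) (auto simp: A_def tree_up_def)
    qed
    then obtain y where y: "y \<in> S" "z \<in> tree_up T lt y - (\<Union>t\<in>F y. tree_up T lt t)"
      by blast
    then have "z \<in> U y" using FU(4)[of y] by (auto simp: S_def)
    with y(1) show ?thesis by blast
  qed
  moreover have "U ` S \<subseteq> \<U>" using FU(1) by (auto simp: S_def)
  ultimately have "\<Union>(U ` S) = T" using \<U> by blast
  with \<open>countable S\<close> \<open>U ` S \<subseteq> \<U>\<close>
  show "\<exists>\<V>. countable \<V> \<and> \<V> \<subseteq> \<U> \<and> \<Union>\<V> = T"
    by (intro exI[of _ "U ` S"]) simp
qed

theorem theorem4p9: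
  fixes T :: "'a set" and lt :: "'a \<Rightarrow> 'a \<Rightarrow> bool"
  assumes "aleph1_tree T lt"
  shows "Lindelof_space (fine_wedge_topology T lt) \<longleftrightarrow>
         (\<forall>S. subtree S T lt \<and> finitely_splitting S lt \<longrightarrow> countable S)"
proof -
  have T: "is_tree T lt" using assms by (simp add: aleph1_tree_def)
  show ?thesis
  proof (intro iffI allI impI)
    fix S
    assume "Lindelof_space (fine_wedge_topology T lt)" "subtree S T lt \<and> finitely_splitting S lt"
    then show "countable S"
      by (auto intro: countable_finitely_splitting_if_Lindelof_fine_wedge[OF T])
  next
    assume "\<forall>S. subtree S T lt \<and> finitely_splitting S lt \<longrightarrow> countable S"
    then show "Lindelof_space (fine_wedge_topology T lt)"
      by (intro Lindelof_fine_wedge_if_countable_finitely_splitting[OF T]) simp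
  qed
qed

end
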